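(* Consider the two-shop ski rental problem with renting prices $1=r_1<r_2$ and buying prices $b_1>b_2>0$, let $\lambda\in(0,1)$, and let $m\ge1$ be the number of predictions. Let $x$ be the actual number of skiing days, let $y_1<y_2<\cdots<y_m$ be the predicted numbers of skiing days, let $z$ be the number of indices $i\in\{1,\dots,m\}$ with $y_i\ge b_2$, and let $\zeta=\max_{i}|y_i-x|$. Consider the deterministic algorithm that, given $y_1,\dots,y_m$: - if $z\ge m/2$, rents at shop $2$ until buying at shop $2$ on day $\left\lceil\frac{\lambda b_2}{2z-m+1}\right\rceil$; - otherwise, rents at shop $1$ until buying at shop $1$ on day $\left\lceil\frac{(m-2z+1)b_2}{\lambda}\right\rceil$. Then the competitive ratio of this algorithm is at most $$\min\left\{(\lambda+1)r_2+\frac{b_1}{b_2}+\max\left\{\lambda r_2+1,\ \frac{1}{1-\lambda}\right\}\frac{\zeta}{\mathrm{OPT}},\ \ \max\left\{r_2,\frac{b_1}{b_2}\right\}+\frac{m+1}{\lambda}\right\},$$ that is, $\mathrm{ALG}/\mathrm{OPT}$ is at most this quantity for all $x$ and all $y_1<\cdots<y_m$. In particular, the algorithm is $\left((\lambda+1)r_2+\frac{b_1}{b_2}\right)$-consistent and $\left(\max\left\{r_2,\frac{b_1}{b_2}\right\}+\frac{m+1}{\lambda}\right)$-robust.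
   Context: A skier skis for an unknown positive integer number $x$ of days. Shop $j\in\{1,2\}$ rents skis for $r_j$ dollars per day and sells them for $b_j$ dollars. The skier must choose one shop at the beginning and then rent or buy only at that shop. Choosing shop $j$ and buying day $d\in\{1,2,\dots\}$ costs $x\,r_j$ if $x<d$ and $(d-1)r_j+b_j$ if $x\ge d$. $\mathrm{ALG}$ is the cost of the algorithm; $\mathrm{OPT}=\min\{x,b_2\}$ is the offline optimal cost (with $x$ known). The predictions $y_1<\cdots<y_m$ are real numbers given to the algorithm; $\zeta=\max_i|y_i-x|$ is the prediction error, unknown to the algorithm. An algorithm is $\alpha$-consistent if $\mathrm{ALG}\le\alpha\cdot\mathrm{OPT}$ whenever $\zeta=0$, and $\beta$-robust if $\mathrm{ALG}\le\beta\cdot\mathrm{OPT}$ for all $x$ and all predictions (hence all $\zeta$). *)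

theory Defs
  imports Complex_Main
begin

datatype shop = Shop1 | Shop2

text \<open>A strategy is a pair of a shop and a buying day (counted from 1); renting forever within
  a horizon of \<open>x\<close> days is the choice of any buying day after \<open>x\<close>.\<close>

type_synonym strategy = "shop \<times> nat"

definition cost :: "(shop \<Rightarrow> real) \<Rightarrow> (shop \<Rightarrow> real) \<Rightarrow> strategy \<Rightarrow> nat \<Rightarrow> real" where
  "cost r b s x =
     (let (j, d) = s in
      if x < d then real x * r j else (real d - 1) * r j + b j)"

text \<open>The offline optimum for renting price 1 at the first shop; see \<open>opt_le_cost\<close> and
  \<open>opt_attained\<close> below.\<close>

definition opt :: "(shop \<Rightarrow> real) \<Rightarrow> nat \<Rightarrow> real" where
  "opt b x = min (real x) (b Shop2)"

definition pred_error :: "real list \<Rightarrow> nat \<Rightarrow> real" where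
  "pred_error ys x = Max ((\<lambda>y. \<bar>y - real x\<bar>) ` set ys)"

text \<open>An instance with \<open>m\<close> predictions: the true number of skiing days and the strictly
  increasing list of predictions.\<close>

definition is_instance :: "nat \<Rightarrow> nat \<Rightarrow> real list \<Rightarrow> bool" where
  "is_instance m x ys \<longleftrightarrow> 1 \<le> x \<and> length ys = m \<and> sorted_wrt (<) ys"

text \<open>A deterministic algorithm maps the predictions to a strategy.\<close>

definition consistent ::
  "(shop \<Rightarrow> real) \<Rightarrow> (shop \<Rightarrow> real) \<Rightarrow> nat \<Rightarrow> (real list \<Rightarrow> strategy) \<Rightarrow> real \<Rightarrow> bool" where
  "consistent r b m A \<alpha> \<longleftrightarrow>
     (\<forall>x ys. is_instance m x ys \<longrightarrow> pred_error ys x = 0 \<longrightarrow>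
        cost r b (A ys) x \<le> \<alpha> * opt b x)"

definition robust ::
  "(shop \<Rightarrow> real) \<Rightarrow> (shop \<Rightarrow> real) \<Rightarrow> nat \<Rightarrow> (real list \<Rightarrow> strategy) \<Rightarrow> real \<Rightarrow> bool" where
  "robust r b m A \<beta> \<longleftrightarrow>
     (\<forall>x ys. is_instance m x ys \<longrightarrow> cost r b (A ys) x \<le> \<beta> * opt b x)"

definition num_ge :: "real \<Rightarrow> real list \<Rightarrow> nat" where
  "num_ge c ys = card {i. i < length ys \<and> c \<le> ys ! i}"

definition ski_alg :: "(shop \<Rightarrow> real) \<Rightarrow> real \<Rightarrow> real list \<Rightarrow> strategy" where
  "ski_alg b \<mu> ys =
     (let m = real (length ys); z = real (num_ge (b Shop2) ys) in
      if m / 2 \<le> z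
      then (Shop2, nat \<lceil>\<mu> * b Shop2 / (2 * z - m + 1)\<rceil>)
      else (Shop1, nat \<lceil>(m - 2 * z + 1) * b Shop2 / \<mu>\<rceil>))"

lemma ski_alg_day_pos:
  assumes "0 < b Shop2" "0 < \<mu>"
  shows "1 \<le> snd (ski_alg b \<mu> ys)"
proof -
  have "1 \<le> nat \<lceil>t\<rceil>" if "0 < t" for t :: real
    using that by linarith
  then show ?thesis
    using assms by (auto simp: ski_alg_def Let_def)
qed

lemma opt_le_cost:
  assumes "r Shop1 = 1" "1 < r Shop2" "b Shop2 < b Shop1" "1 \<le> d"
  shows "opt b x \<le> cost r b (j, d) x"
proof -
  have r: "1 \<le> r j" and b: "b Shop2 \<le> b j"
    using assms by (cases j; simp)+
  have "real x \<le> real x * r j"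
    using r mult_left_mono[of 1 "r j" "real x"] by simp
  moreover have "0 \<le> (real d - 1) * r j"
    using r assms(4) by simp
  ultimately show ?thesis
    using b by (auto simp: cost_def opt_def)
qed

lemma opt_attained:
  assumes "r Shop1 = 1" "1 \<le> x"
  shows "\<exists>j d. 1 \<le> d \<and> cost r b (j, d) x = opt b x"
proof (cases "real x \<le> b Shop2")
  case True
  then have "cost r b (Shop1, Suc x) x = opt b x"
    using assms by (simp add: cost_def opt_def)
  then show ?thesis by (metis le_add1 plus_1_eq_Suc)
next
  case False
  then have "cost r b (Shop2, 1) x = opt b x"
    using assms by (simp add: cost_def opt_def)
  then show ?thesis by blast
qed

end

theory Submission
  imports Defs
begin

text \<open>If at least half of the predictions are \<open>\<ge> b\<^sub>2\<close>, then one of them is, so \<open>x < b\<^sub>2\<close> forces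
  \<open>\<zeta> \<ge> b\<^sub>2 - x\<close>; otherwise some prediction is \<open>< b\<^sub>2\<close>, so \<open>x > b\<^sub>2\<close> forces \<open>\<zeta> \<ge> x - b\<^sub>2\<close>. In both cases
  the error pays for the wrong choice of shop. The robust bound does not look at the error:
  the divisor \<open>2z - m + 1\<close>, respectively the factor \<open>m - 2z + 1\<close>, lies between \<open>1\<close> and \<open>m + 1\<close>,
  so the buying day lies, up to rounding, between \<open>\<lambda> b\<^sub>2 / (m + 1)\<close> and \<open>(m + 1) b\<^sub>2 / \<lambda>\<close>.\<close>

lemma num_ge_le_length: "num_ge c ys \<le> length ys"
proof -
  have "card {i. i < length ys \<and> c \<le> ys ! i} \<le> card {..<length ys}"
    by (intro card_mono) auto
  then show ?thesis by (simp add: num_ge_def)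
qed

lemma num_ge_pos_obtains:
  assumes "0 < num_ge c ys"
  obtains y where "y \<in> set ys" "c \<le> y"
proof -
  from assms have "{i. i < length ys \<and> c \<le> ys ! i} \<noteq> {}"
    unfolding num_ge_def by (metis card.empty less_irrefl)
  then show thesis using that nth_mem by blast
qed

lemma num_ge_less_obtains:
  assumes "num_ge c ys < length ys"
  obtains y where "y \<in> set ys" "y < c"
proof -
  have "{i. i < length ys \<and> c \<le> ys ! i} \<noteq> {..<length ys}"
    using assms unfolding num_ge_def by (metis card_lessThan less_irrefl)
  then obtain i where "i < length ys" "\<not> c \<le> ys ! i" by auto
  then show thesis using that nth_mem by force
qed

lemma abs_diff_le_pred_error:
  "y \<in> set ys \<Longrightarrow> \<bar>y - real x\<bar> \<le> pred_error ys x"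
  unfolding pred_error_def by (intro Max_ge) auto

text \<open>The first bound shows that buying happens only for \<open>x\<close> at least
  \<open>t\<close>; the second limits the \<open>d - 1\<close> days of rent paid before
  buying.\<close>

lemma ceiling_day_bounds:
  fixes t :: real
  assumes "0 < t" "d = nat \<lceil>t\<rceil>"
  shows "t \<le> real d" "real d - 1 < t"
  using assms by linarith+

text \<open>Here \<open>k\<close> stands for the divisor \<open>2 * z - m + 1\<close> and
  \<open>e\<close> for the prediction error. The first bound uses that the rent paid before buying
  is below \<open>\<mu> * b Shop2 * r Shop2\<close>; the second, that buying requires
  \<open>x\<close> to be at least \<open>\<mu> * b Shop2 / k\<close>.\<close>

lemma cost_shop2_le:
  fixes k \<mu> :: real
  assumes r: "1 < r Shop2" and b: "0 < b Shop2" and \<mu>: "0 < \<mu>" "\<mu> < 1" and k: "1 \<le> k"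
    and d: "d = nat \<lceil>\<mu> * b Shop2 / k\<rceil>"
    and err: "b Shop2 - real x \<le> e" "0 \<le> e"
  shows "cost r b (Shop2, d) x \<le> (\<mu> + 1) * r Shop2 * opt b x + (\<mu> * r Shop2 + 1) * e"
    and "cost r b (Shop2, d) x \<le> (r Shop2 + k / \<mu>) * opt b x"
proof -
  let ?R = "r Shop2" and ?B = "b Shop2"
  have "0 < \<mu> * ?B / k" using b \<mu> k by simp
  note day = ceiling_day_bounds[OF this d]
  have "\<mu> * ?B / k \<le> \<mu> * ?B" using b \<mu> k by (simp add: divide_le_eq)
  then have dB: "real d - 1 < \<mu> * ?B" using day by linarith
  have \<mu>B: "\<mu> * ?B < ?B" using b \<mu> by simp
  have \<mu>R: "0 < \<mu> * ?R" using r \<mu> by simp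
  have k\<mu>: "1 < k / \<mu>" using k \<mu> by simp
  have opt0: "0 \<le> opt b x" using b by (simp add: opt_def)
  \<comment> \<open>After expansion this is just \<open>1 \<le> ?R\<close>.\<close>
  have coeff: "\<mu> * ?R + 1 \<le> (\<mu> + 1) * ?R" using r by (simp add: algebra_simps)
  consider (rent) "x < d" | (buy_long) "d \<le> x" "?B \<le> real x" | (buy_short) "d \<le> x" "real x < ?B"
    by linarith
  then have "cost r b (Shop2, d) x \<le> (\<mu> + 1) * ?R * opt b x + (\<mu> * ?R + 1) * e \<and>
    cost r b (Shop2, d) x \<le> (?R + k / \<mu>) * opt b x"
  proof cases
    case rent
    \<comment> \<open>Integrality turns \<open>x < d\<close> into \<open>x \<le> d - 1\<close>,
      which is below \<open>?B\<close>; so the optimum rents as well, at price 1, and the ratio is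
      exactly \<open>?R\<close>.\<close>
    then have "real x \<le> real d - 1" by linarith
    then have "opt b x = real x" using dB \<mu>B by (simp add: opt_def)
    then have c: "cost r b (Shop2, d) x = ?R * opt b x" using rent by (simp add: cost_def)
    have "?R * opt b x \<le> (\<mu> + 1) * ?R * opt b x"
      using \<mu>R opt0 by (intro mult_right_mono) (auto simp: algebra_simps)
    moreover have "?R * opt b x \<le> (?R + k / \<mu>) * opt b x"
      using k\<mu> opt0 by (intro mult_right_mono) auto
    moreover have "0 \<le> (\<mu> * ?R + 1) * e" using \<mu>R err by simp
    ultimately show ?thesis using c by linarith
  next
    case buy_long
    then have o: "opt b x = ?B" by (simp add: opt_def)
    have "(real d - 1) * ?R \<le> (\<mu> * ?B) * ?R" using dB r by (intro mult_right_mono) auto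
    then have c: "cost r b (Shop2, d) x \<le> (\<mu> * ?R + 1) * ?B"
      using buy_long by (simp add: cost_def algebra_simps)
    have "(\<mu> * ?R + 1) * ?B \<le> (\<mu> + 1) * ?R * ?B" using coeff b by (intro mult_right_mono) auto
    moreover have "\<mu> * ?R \<le> ?R" using r \<mu> by simp
    then have "(\<mu> * ?R + 1) * ?B \<le> (?R + k / \<mu>) * ?B"
      using k\<mu> b by (intro mult_right_mono) linarith+
    moreover have "0 \<le> (\<mu> * ?R + 1) * e" using \<mu>R err by simp
    ultimately show ?thesis using c o by simp
  next
    case buy_short
    then have o: "opt b x = real x" by (simp add: opt_def)
    have "(real d - 1) * ?R \<le> (\<mu> * ?B) * ?R" using dB r by (intro mult_right_mono) auto
    then have "cost r b (Shop2, d) x \<le> (\<mu> * ?R + 1) * ?B"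
      using buy_short by (simp add: cost_def algebra_simps)
    \<comment> \<open>Only here does the first bound need the error: the purchase is premature, and
      \<open>?B\<close> exceeds the optimum \<open>x\<close> by at most \<open>e\<close>.\<close>
    also have "\<dots> \<le> (\<mu> * ?R + 1) * (real x + e)"
      using \<mu>R err by (intro mult_left_mono) auto
    also have "\<dots> = (\<mu> * ?R + 1) * opt b x + (\<mu> * ?R + 1) * e"
      by (simp add: o distrib_left)
    also have "\<dots> \<le> (\<mu> + 1) * ?R * opt b x + (\<mu> * ?R + 1) * e"
      using mult_right_mono[OF coeff opt0] by linarith
    finally have 1: "cost r b (Shop2, d) x \<le> (\<mu> + 1) * ?R * opt b x + (\<mu> * ?R + 1) * e" .
    have "(real d - 1) * ?R \<le> real x * ?R" using buy_short r by (intro mult_right_mono) auto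
    \<comment> \<open>Without the error, the price \<open>?B\<close> is charged to the days skied
      before the purchase was triggered.\<close>
    moreover have "\<mu> * ?B / k \<le> real x" using day buy_short by linarith
    then have "?B \<le> k / \<mu> * real x" using \<mu> k by (simp add: field_simps)
    ultimately show ?thesis using 1 buy_short o by (simp add: cost_def algebra_simps)
  qed
  then show "cost r b (Shop2, d) x \<le> (\<mu> + 1) * ?R * opt b x + (\<mu> * ?R + 1) * e"
    and "cost r b (Shop2, d) x \<le> (?R + k / \<mu>) * opt b x" by blast+
qed

text \<open>Here \<open>k\<close> stands for the factor \<open>m - 2 * z + 1\<close>. Since
  \<open>k / \<mu>\<close> exceeds 1, the buying day is not before \<open>b Shop2\<close>. Hence a
  purchase happens only when the optimum is \<open>b Shop2\<close>, and \<open>b Shop1\<close> costs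
  \<open>b Shop1 / b Shop2\<close> times that optimum.\<close>

lemma cost_shop1_le:
  fixes k \<mu> :: real
  assumes r: "r Shop1 = 1" and b: "0 < b Shop2" "0 < b Shop1" and \<mu>: "0 < \<mu>" "\<mu> < 1" and k: "1 \<le> k"
    and d: "d = nat \<lceil>k * b Shop2 / \<mu>\<rceil>"
    and err: "real x - b Shop2 \<le> e" "0 \<le> e"
  shows "cost r b (Shop1, d) x \<le> (1 + b Shop1 / b Shop2) * opt b x + e"
    and "cost r b (Shop1, d) x \<le> (b Shop1 / b Shop2 + k / \<mu>) * opt b x"
proof -
  let ?B = "b Shop2" and ?q = "b Shop1 / b Shop2"
  have "0 < k * ?B / \<mu>" using b \<mu> k by simp
  note day = ceiling_day_bounds[OF this d]
  have k\<mu>: "1 < k / \<mu>" using k \<mu> by simp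
  have "?B * 1 \<le> ?B * (k / \<mu>)" using k\<mu> b by (intro mult_left_mono) auto
  then have B: "?B \<le> k * ?B / \<mu>" by (simp add: mult.commute)
  have q: "0 < ?q" "?q * ?B = b Shop1" using b by auto
  have opt0: "0 \<le> opt b x" using b by (simp add: opt_def)
  have opt_coeffs: "opt b x \<le> (1 + ?q) * opt b x" "opt b x \<le> (?q + k / \<mu>) * opt b x"
    using mult_right_mono[of 1 "1 + ?q" "opt b x"] mult_right_mono[of 1 "?q + k / \<mu>" "opt b x"]
      q k\<mu> opt0 by auto
  consider (short) "x < d" "real x \<le> ?B" | (rent) "x < d" "?B < real x" | (buy) "d \<le> x"
    by linarith
  then have "cost r b (Shop1, d) x \<le> (1 + ?q) * opt b x + e \<and>
    cost r b (Shop1, d) x \<le> (?q + k / \<mu>) * opt b x"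
  proof cases
    case short
    then have "cost r b (Shop1, d) x = opt b x" using r by (simp add: cost_def opt_def)
    then show ?thesis using opt_coeffs err by linarith
  next
    case rent
    then have o: "opt b x = ?B" and c: "cost r b (Shop1, d) x = real x"
      using r by (auto simp: cost_def opt_def)
    \<comment> \<open>The cost \<open>x\<close> is at most \<open>?B + e\<close> by the error bound,
      and at most \<open>k / \<mu> * ?B\<close> because the buying day is not reached.\<close>
    have "real x \<le> real d - 1" using rent by linarith
    then have "real x \<le> k / \<mu> * ?B" using day by simp
    then show ?thesis using c o err q b by (simp add: distrib_right)
  next
    case buy
    then have "?B \<le> real x" using B day by linarith
    then have o: "opt b x = ?B" by (simp add: opt_def)
    have c: "cost r b (Shop1, d) x = real d - 1 + b Shop1"
      using buy r by (simp add: cost_def)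
    \<comment> \<open>The rent is bounded twice: through \<open>x \<le> ?B + e\<close> for the first
      claim, through the choice of the day for the second.\<close>
    have "real d - 1 \<le> real x" "real d - 1 \<le> k / \<mu> * ?B" using buy day by auto
    then show ?thesis using c o q err by (simp add: distrib_right)
  qed
  then show "cost r b (Shop1, d) x \<le> (1 + ?q) * opt b x + e"
    and "cost r b (Shop1, d) x \<le> (?q + k / \<mu>) * opt b x" by blast+
qed

text \<open>Both branches are weakened to common coefficients. Keeping \<open>opt b x\<close> as a
  factor lets the ratio, consistency and robustness all be read off.\<close>

lemma cost_ski_alg_le:
  fixes r b :: "shop \<Rightarrow> real" and \<mu> :: real
  assumes r: "r Shop1 = 1" "r Shop1 < r Shop2"
    and b: "b Shop2 < b Shop1" "0 < b Shop2"
    and \<mu>: "0 < \<mu>" "\<mu> < 1"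
    and ys: "ys \<noteq> []"
  shows "cost r b (ski_alg b \<mu> ys) x \<le> ((\<mu> + 1) * r Shop2 + b Shop1 / b Shop2) * opt b x
           + max (\<mu> * r Shop2 + 1) (1 / (1 - \<mu>)) * pred_error ys x"
    and "cost r b (ski_alg b \<mu> ys) x
           \<le> (max (r Shop2) (b Shop1 / b Shop2) + (real (length ys) + 1) / \<mu>) * opt b x"
proof -
  let ?R = "r Shop2" and ?B = "b Shop2" and ?q = "b Shop1 / b Shop2"
  let ?e = "pred_error ys x" and ?M = "max (\<mu> * ?R + 1) (1 / (1 - \<mu>))"
  define m z where "m = length ys" and "z = num_ge ?B ys"
  have zm: "z \<le> m" and m: "1 \<le> m"
    using num_ge_le_length ys by (auto simp: m_def z_def Suc_le_eq)
  have R: "1 < ?R" using r by simp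
  have q: "0 < ?q" using b by simp
  have opt0: "0 \<le> opt b x" using b by (simp add: opt_def)
  \<comment> \<open>Some prediction exists, so the maximum dominates a nonnegative distance.\<close>
  have "0 \<le> \<bar>hd ys - real x\<bar>" by simp
  also have "\<dots> \<le> ?e" using ys by (intro abs_diff_le_pred_error) simp
  finally have e: "0 \<le> ?e" .
  have robustI: "(s + k / \<mu>) * opt b x \<le> (max ?R ?q + (real m + 1) / \<mu>) * opt b x"
    if "s \<le> max ?R ?q" "k \<le> real m + 1" for s k
    using that \<mu> opt0 by (intro mult_right_mono add_mono divide_right_mono) auto
  have "cost r b (ski_alg b \<mu> ys) x \<le> ((\<mu> + 1) * ?R + ?q) * opt b x + ?M * ?e \<and>
    cost r b (ski_alg b \<mu> ys) x \<le> (max ?R ?q + (real m + 1) / \<mu>) * opt b x"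
  proof (cases "real m / 2 \<le> real z")
    case True
    define k where "k = 2 * real z - real m + 1"
    \<comment> \<open>The lower bound is the branch condition, the upper one is
      \<open>z \<le> m\<close>.\<close>
    have k: "1 \<le> k" "k \<le> real m + 1" using True zm by (auto simp: k_def)
    have alg: "ski_alg b \<mu> ys = (Shop2, nat \<lceil>\<mu> * ?B / k\<rceil>)"
      using True by (simp add: ski_alg_def k_def m_def z_def Let_def)
    have "0 < z" using True m by linarith
    then obtain y where "y \<in> set ys" "?B \<le> y" unfolding z_def by (rule num_ge_pos_obtains)
    then have err: "?B - real x \<le> ?e" using abs_diff_le_pred_error[of y ys x] by linarith
    note c = cost_shop2_le[where r = r and b = b and x = x, OF R b(2) \<mu> k(1) refl err e]
    have "(\<mu> + 1) * ?R * opt b x \<le> ((\<mu> + 1) * ?R + ?q) * opt b x"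
      using q opt0 by (intro mult_right_mono) auto
    moreover have "(\<mu> * ?R + 1) * ?e \<le> ?M * ?e" using e by (intro mult_right_mono) auto
    ultimately show ?thesis using c robustI[of ?R k] k unfolding alg by fastforce
  next
    case False
    define k where "k = real m - 2 * real z + 1"
    have k: "1 \<le> k" "k \<le> real m + 1" using False by (auto simp: k_def)
    have alg: "ski_alg b \<mu> ys = (Shop1, nat \<lceil>k * ?B / \<mu>\<rceil>)"
      using False by (simp add: ski_alg_def k_def m_def z_def Let_def)
    have "z < m" using False by linarith
    then obtain y where "y \<in> set ys" "y < ?B"
      unfolding z_def m_def by (rule num_ge_less_obtains)
    then have err: "real x - ?B \<le> ?e" using abs_diff_le_pred_error[of y ys x] by linarith
    have "0 < b Shop1" using b by simp
    note c = cost_shop1_le[where r = r and b = b and x = x, OF r(1) b(2) this \<mu> k(1) refl err e]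
    have "0 < \<mu> * ?R" using \<mu> R by simp
    \<comment> \<open>This absorbs the coefficient 1 of shop 1 into the coefficient arising from
      shop 2.\<close>
    then have "1 \<le> (\<mu> + 1) * ?R" using R by (simp add: distrib_right)
    then have "(1 + ?q) * opt b x \<le> ((\<mu> + 1) * ?R + ?q) * opt b x"
      using opt0 by (intro mult_right_mono) auto
    moreover have "1 * ?e \<le> ?M * ?e"
      using e \<open>0 < \<mu> * ?R\<close> by (intro mult_right_mono) auto
    ultimately show ?thesis using c robustI[of ?q k] k unfolding alg by fastforce
  qed
  then show "cost r b (ski_alg b \<mu> ys) x \<le> ((\<mu> + 1) * ?R + ?q) * opt b x + ?M * ?e"
    and "cost r b (ski_alg b \<mu> ys) x
           \<le> (max ?R ?q + (real (length ys) + 1) / \<mu>) * opt b x"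
    by (simp_all add: m_def)
qed

theorem theorem3:
  fixes r b :: "shop \<Rightarrow> real" and \<mu> :: real and m :: nat
  assumes "r Shop1 = 1" and "r Shop1 < r Shop2"
    and "b Shop2 < b Shop1" and "0 < b Shop2"
    and "0 < \<mu>" and "\<mu> < 1"
    and "1 \<le> m"
  shows "(\<forall>x ys. is_instance m x ys \<longrightarrow>
            cost r b (ski_alg b \<mu> ys) x / opt b x
              \<le> min ((\<mu> + 1) * r Shop2 + b Shop1 / b Shop2
                       + max (\<mu> * r Shop2 + 1) (1 / (1 - \<mu>)) * (pred_error ys x / opt b x))
                    (max (r Shop2) (b Shop1 / b Shop2) + (real m + 1) / \<mu>))
         \<and> consistent r b m (ski_alg b \<mu>) ((\<mu> + 1) * r Shop2 + b Shop1 / b Shop2)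
         \<and> robust r b m (ski_alg b \<mu>) (max (r Shop2) (b Shop1 / b Shop2) + (real m + 1) / \<mu>)"
proof -
  let ?A = "(\<mu> + 1) * r Shop2 + b Shop1 / b Shop2"
  let ?M = "max (\<mu> * r Shop2 + 1) (1 / (1 - \<mu>))"
  let ?C = "max (r Shop2) (b Shop1 / b Shop2) + (real m + 1) / \<mu>"
  have bounds: "cost r b (ski_alg b \<mu> ys) x \<le> ?A * opt b x + ?M * pred_error ys x"
    "cost r b (ski_alg b \<mu> ys) x \<le> ?C * opt b x" if "is_instance m x ys" for x ys
  proof -
    have "length ys = m" using that by (simp add: is_instance_def)
    moreover from this have "ys \<noteq> []" using assms(7) by auto
    ultimately show "cost r b (ski_alg b \<mu> ys) x \<le> ?A * opt b x + ?M * pred_error ys x"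
      "cost r b (ski_alg b \<mu> ys) x \<le> ?C * opt b x"
      using cost_ski_alg_le[OF assms(1-6), of ys x] by simp_all
  qed
  have "cost r b (ski_alg b \<mu> ys) x / opt b x
      \<le> min (?A + ?M * (pred_error ys x / opt b x)) ?C" if "is_instance m x ys" for x ys
  proof -
    \<comment> \<open>At least one day of skiing makes the optimum positive, so dividing by it is
      legitimate.\<close>
    have opt: "0 < opt b x" using that assms(4) by (simp add: is_instance_def opt_def)
    then have "(?A + ?M * (pred_error ys x / opt b x)) * opt b x
        = ?A * opt b x + ?M * pred_error ys x"
      by (simp add: distrib_right)
    then show ?thesis
      using bounds[OF that] opt by (simp only: min.bounded_iff pos_divide_le_eq)
  qed
  \<comment> \<open>With zero error the second summand of the first bound vanishes.\<close>
  moreover have "consistent r b m (ski_alg b \<mu>) ?A"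
    unfolding consistent_def using bounds(1) by fastforce
  moreover have "robust r b m (ski_alg b \<mu>) ?C"
    unfolding robust_def using bounds(2) by blast
  ultimately show ?thesis by blast
qed

end
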